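(* For every badly approximable real number $\beta>0$, $$\dim_H([0,1]\setminus\mathcal{A}(\bm{a}(\beta)))=\dim_H([0,1]\setminus\mathcal{A}(\bm{b}(\beta)))=1.$$
   Context: $\dim_H$ is Hausdorff dimension. The index $p$ runs over primes; $n_p\geq1$ is the integer such that $p$ is the $n_p$-th prime in increasing order. For an integer $n$ and a prime $p$, $n\pmod p$ denotes the unique integer in $\{0,\ldots,p-1\}$ congruent to $n$ modulo $p$. For a real number $\beta>0$, $\bm{a}(\beta)=(a_p)_p$ and $\bm{b}(\beta)=(b_p)_p$ are given by $a_p=\lfloor\beta pn_p\rfloor\pmod p$ and $b_p=\lfloor\beta p^2\rfloor\pmod p$. For a sequence $\bm{a}=(a_p)_p$ of integers with $0\leq a_p<p$, $\mathcal{A}(\bm{a})=\{x\in[0,1] : \liminf_{p\to\infty}p|x-a_p/p|=0\}$. A real number $\beta$ is badly approximable if there exists $c=c(\beta)>0$ such that $|\beta-\frac{a}{q}|>\frac{c}{q^2}$ for all integers $a$ and $q\geq1$. *)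

theory Defs
  imports "HOL-Analysis.Analysis" "HOL-Computational_Algebra.Primes"
begin

text \<open>
  The case distinction in the gauge implements the usual conventions
  \<open>diam({})^s = 0\<close> and \<open>diam(U)^0 = 1\<close> for nonempty \<open>U\<close>; the latter must be forced
  because \<open>0 powr 0 = 0\<close>. Boundedness is demanded of the covering sets because
  \<^const>\<open>diameter\<close> is unspecified on unbounded sets.
\<close>

definition hausdorff_gauge :: "real \<Rightarrow> 'a::metric_space set \<Rightarrow> ennreal" where
  "hausdorff_gauge s U =
     (if U = {} then 0 else if s = 0 then 1 else ennreal (diameter U powr s))"

definition hausdorff_premeasure :: "real \<Rightarrow> real \<Rightarrow> 'a::metric_space set \<Rightarrow> ennreal" where
  "hausdorff_premeasure s \<delta> E =
     (INF U \<in> {U :: nat \<Rightarrow> 'a set. E \<subseteq> (\<Union>i. U i) \<and> (\<forall>i. bounded (U i) \<and> diameter (U i) \<le> \<delta>)}.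
        (\<Sum>i. hausdorff_gauge s (U i)))"

definition hausdorff_measure :: "real \<Rightarrow> 'a::metric_space set \<Rightarrow> ennreal" where
  "hausdorff_measure s E = (SUP \<delta> \<in> {0<..}. hausdorff_premeasure s \<delta> E)"

definition hausdorff_dim :: "'a::metric_space set \<Rightarrow> ennreal" where
  "hausdorff_dim E = (INF s \<in> {s. 0 \<le> s \<and> hausdorff_measure s E = 0}. ennreal s)"

definition badly_approximable :: "real \<Rightarrow> bool" where
  "badly_approximable \<beta> \<longleftrightarrow>
     (\<exists>c>0. \<forall>(a::int) (q::int). q \<ge> 1 \<longrightarrow> \<bar>\<beta> - of_int a / of_int q\<bar> > c / (of_int q)^2)"

text \<open>\<^const>\<open>enumerate\<close> counts from \<open>0\<close>, whereas \<open>n\<^sub>p\<close> counts from \<open>1\<close>.\<close>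

definition prime_index :: "nat \<Rightarrow> nat" where
  "prime_index p = (THE n. 1 \<le> n \<and> enumerate {q::nat. prime q} (n - 1) = p)"

lemma enumerate_prime_index:
  fixes p :: nat
  assumes "prime p"
  shows "1 \<le> prime_index p" "enumerate {q::nat. prime q} (prime_index p - 1) = p"
proof -
  have inf: "infinite {q::nat. prime q}"
    by (rule primes_infinite)
  obtain k where k: "enumerate {q::nat. prime q} k = p"
    using enumerate_Ex[of "{q::nat. prime q}" p] inf assms by auto
  have "\<exists>!n. 1 \<le> n \<and> enumerate {q::nat. prime q} (n - 1) = p"
  proof (rule ex1I[of _ "Suc k"])
    show "1 \<le> Suc k \<and> enumerate {q::nat. prime q} (Suc k - 1) = p"
      using k by simp
  next
    fix n
    assume n: "1 \<le> n \<and> enumerate {q::nat. prime q} (n - 1) = p"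
    have "inj (enumerate {q::nat. prime q})"
      using strict_mono_enumerate[OF inf] by (rule strict_mono_imp_inj_on)
    then have "n - 1 = k"
      using n k by (metis injD)
    then show "n = Suc k"
      using n by linarith
  qed
  from theI'[OF this]
  show "1 \<le> prime_index p" "enumerate {q::nat. prime q} (prime_index p - 1) = p"
    by (auto simp: prime_index_def)
qed

text \<open>
  Sequences indexed by primes are functions on \<^typ>\<open>nat\<close> whose values off the primes are
  irrelevant; accordingly, the limit inferior is taken along the filter of primes tending to
  infinity.
\<close>

definition primes_at_top :: "nat filter" where
  "primes_at_top = inf sequentially (principal {p. prime p})"

definition prime_approx_set :: "(nat \<Rightarrow> int) \<Rightarrow> real set" where
  "prime_approx_set a =
     {x \<in> {0..1}. Liminf primes_at_top (\<lambda>p. ereal (real p * \<bar>x - of_int (a p) / real p\<bar>)) = 0}"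

definition seq_a :: "real \<Rightarrow> nat \<Rightarrow> int" where
  "seq_a \<beta> p = \<lfloor>\<beta> * real p * real (prime_index p)\<rfloor> mod int p"

definition seq_b :: "real \<Rightarrow> nat \<Rightarrow> int" where
  "seq_b \<beta> p = \<lfloor>\<beta> * (real p)^2\<rfloor> mod int p"

end

theory Submission
  imports Defs
begin

text \<open>
  Write \<open>q\<^sub>p\<close> for \<open>n\<^sub>p\<close> respectively \<open>p\<close>. In both cases \<open>q\<^sub>p \<le> p\<close> and \<open>p \<mapsto> q\<^sub>p\<close> is injective, and
  \<open>a\<^sub>p / p\<close> differs from \<open>\<beta> q\<^sub>p\<close> modulo \<open>1\<close> by at most \<open>1 / p \<le> 1 / q\<^sub>p\<close>. Bad approximability makes the
  numbers \<open>\<beta> q\<^sub>p\<close> with \<open>q\<^sub>p\<close> in a dyadic block \<open>[A, 2A)\<close> pairwise \<open>c / A\<close>-separated modulo \<open>1\<close>. Hence,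
  for \<open>\<delta>\<close> small in terms of \<open>c\<close> and \<open>R = 2\<^sup>m\<close> large, if an interval of length \<open>\<delta> / R\<^sup>k\<close> is cut into
  \<open>R\<close> equal pieces, at most half of them come within \<open>\<delta> / (R p)\<close> of some \<open>a\<^sub>p / p\<close> with
  \<open>R\<^sup>k \<le> q\<^sub>p < R\<^sup>k\<^sup>+\<^sup>1\<close>. Iterating over \<open>k\<close> gives a Cantor set inside the complement which is the image
  of \<open>[0, 1)\<close> under a map whose inverse is Hoelder of exponent \<open>(m - 1) / m\<close>. Its dimension is at least
  \<open>(m - 1) / m\<close>, and \<open>m\<close> is arbitrarily large.
\<close>

section \<open>Bounds for Hausdorff dimension\<close>

lemma diameter_powr_le_hausdorff_gauge:
  fixes U :: "'a::metric_space set"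
  assumes "bounded U" "diameter U \<le> 1" "U \<noteq> {}" "0 \<le> s" "s \<le> \<sigma>"
  shows "ennreal (diameter U powr \<sigma>) \<le> hausdorff_gauge s U"
proof -
  have d: "0 \<le> diameter U"
    by (rule diameter_ge_0[OF assms(1)])
  show ?thesis
  proof (cases "s = 0")
    case True
    then show ?thesis
      using assms d by (simp add: hausdorff_gauge_def powr_le1)
  next
    case False
    then show ?thesis
      using assms d by (auto simp: hausdorff_gauge_def intro!: ennreal_leI powr_mono')
  qed
qed

text \<open>A cover of \<open>E\<close> pulls back to a cover of the unit interval by sets lying in
  intervals of length \<open>2 * K * diameter (U i) powr \<sigma>\<close>. Countable subadditivity
  of Lebesgue measure then keeps the gauge sum away from 0 for every exponent
  \<open>s \<le> \<sigma>\<close>.\<close>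

lemma hausdorff_dim_ge_of_Hoelder_inverse:
  fixes g :: "real \<Rightarrow> 'a::metric_space"
  assumes g: "\<And>t. t \<in> {0..<1} \<Longrightarrow> g t \<in> E"
    and hoelder: "\<And>t t'. t \<in> {0..<1} \<Longrightarrow> t' \<in> {0..<1} \<Longrightarrow> \<bar>t - t'\<bar> \<le> K * dist (g t) (g t') powr \<sigma>"
    and K: "K > 0" and \<sigma>: "\<sigma> > 0"
  shows "ennreal \<sigma> \<le> hausdorff_dim E"
  unfolding hausdorff_dim_def
proof (rule INF_greatest)
  fix s assume "s \<in> {s. 0 \<le> s \<and> hausdorff_measure s E = 0}"
  then have s0: "0 \<le> s" and zero: "hausdorff_measure s E = 0" by auto
  have "\<sigma> \<le> s"
  proof (rule ccontr)
    assume "\<not> \<sigma> \<le> s"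
    then have s\<sigma>: "s \<le> \<sigma>" by simp
    \<comment> \<open>One scale suffices, since the measure is a supremum over scales. At scale 1
      all diameters are at most 1, so the gauge with exponent \<open>s\<close> dominates the power
      \<open>\<sigma>\<close>.\<close>
    have "ennreal (1 / (2 * K)) \<le> hausdorff_premeasure s 1 E"
      unfolding hausdorff_premeasure_def
    proof (rule INF_greatest)
      fix U :: "nat \<Rightarrow> 'a set"
      assume "U \<in> {U. E \<subseteq> (\<Union>i. U i) \<and> (\<forall>i. bounded (U i) \<and> diameter (U i) \<le> 1)}"
      then have cover: "E \<subseteq> (\<Union>i. U i)" and bd: "\<And>i. bounded (U i)" and dm: "\<And>i. diameter (U i) \<le> 1"
        by auto
      have "\<exists>a b. (\<forall>t\<in>{0..<1}. g t \<in> U i \<longrightarrow> t \<in> {a..b}) \<and> a \<le> b \<and>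
              ennreal (1 / (2 * K)) * ennreal (b - a) \<le> hausdorff_gauge s (U i)" for i
      proof (cases "\<exists>t\<in>{0..<1}. g t \<in> U i")
        case False
        then show ?thesis by (intro exI[of _ 0]) auto
      next
        case True
        then obtain t0 where t0: "t0 \<in> {0..<1}" "g t0 \<in> U i" by auto
        \<comment> \<open>All parameters sent into \<open>U i\<close> lie within \<open>r\<close> of
          \<open>t0\<close>. The enclosing interval has length \<open>2 * r\<close>, hence the 2 in
          \<open>1 / (2 * K)\<close>.\<close>
        define r where "r = K * diameter (U i) powr \<sigma>"
        have r0: "0 \<le> r" using K by (simp add: r_def)
        have "t \<in> {t0 - r..t0 + r}" if t: "t \<in> {0..<1}" "g t \<in> U i" for t
        proof -
          have "dist (g t) (g t0) powr \<sigma> \<le> diameter (U i) powr \<sigma>"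
            using diameter_bounded_bound[OF bd t(2) t0(2)] \<sigma> by (intro powr_mono2) auto
          then have "\<bar>t - t0\<bar> \<le> r"
            using hoelder[OF t(1) t0(1)] K unfolding r_def
            by (meson less_eq_real_def mult_left_mono order_trans)
          then show ?thesis by auto
        qed
        moreover have "ennreal (1 / (2 * K)) * ennreal ((t0 + r) - (t0 - r)) = ennreal (diameter (U i) powr \<sigma>)"
          using K r0 by (simp add: ennreal_mult[symmetric] r_def)
        moreover have "ennreal (diameter (U i) powr \<sigma>) \<le> hausdorff_gauge s (U i)"
          using diameter_powr_le_hausdorff_gauge[OF bd dm _ s0 s\<sigma>] t0 by auto
        ultimately show ?thesis
          using r0 by (intro exI[of _ "t0 - r"] exI[of _ "t0 + r"]) auto
      qed
      then obtain a b where ab: "\<And>i t. t \<in> {0..<1} \<Longrightarrow> g t \<in> U i \<Longrightarrow> t \<in> {a i..b i}"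
        and le: "\<And>i. a i \<le> b i"
        and gauge: "\<And>i. ennreal (1 / (2 * K)) * ennreal (b i - a i) \<le> hausdorff_gauge s (U i)"
        by metis
      have "{0..<1} \<subseteq> (\<Union>i. {a i..b i})"
      proof
        fix t :: real assume t: "t \<in> {0..<1}"
        then obtain i where "g t \<in> U i" using g[OF t] cover by auto
        then show "t \<in> (\<Union>i. {a i..b i})" using ab[OF t] by blast
      qed
      then have "emeasure lborel {0..<1::real} \<le> emeasure lborel (\<Union>i. {a i..b i})"
        by (intro emeasure_mono) auto
      also have "\<dots> \<le> (\<Sum>i. emeasure lborel {a i..b i})"
        by (intro emeasure_subadditive_countably) auto
      finally have "1 \<le> (\<Sum>i. ennreal (b i - a i))"
        using le by simp
      then have "ennreal (1 / (2 * K)) * 1 \<le> ennreal (1 / (2 * K)) * (\<Sum>i. ennreal (b i - a i))"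
        by (intro mult_left_mono) auto
      also have "\<dots> = (\<Sum>i. ennreal (1 / (2 * K)) * ennreal (b i - a i))"
        by (rule ennreal_suminf_cmult[symmetric])
      also have "\<dots> \<le> (\<Sum>i. hausdorff_gauge s (U i))"
        by (intro suminf_le gauge) auto
      finally show "ennreal (1 / (2 * K)) \<le> (\<Sum>i. hausdorff_gauge s (U i))" by simp
    qed
    also have "\<dots> \<le> hausdorff_measure s E"
      unfolding hausdorff_measure_def by (rule SUP_upper) auto
    finally show False using zero K by simp
  qed
  then show "ennreal \<sigma> \<le> ennreal s" by (rule ennreal_leI)
qed

text \<open>A cover by \<open>M\<close> intervals of length \<open>1 / M\<close> has gauge sum
  \<open>M powr (1 - s)\<close>, which tends to 0.\<close>

lemma hausdorff_measure_unit_interval_eq_0: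
  fixes E :: "real set"
  assumes E: "E \<subseteq> {0..1}" and s: "s > 1"
  shows "hausdorff_measure s E = 0"
proof -
  have "hausdorff_premeasure s \<delta> E \<le> 0" if \<delta>: "\<delta> > 0" for \<delta>
  proof (rule LIMSEQ_le_const)
    have "(\<lambda>n. real (Suc n) powr (1 - s)) \<longlonglongrightarrow> 0"
      using s by (intro tendsto_neg_powr filterlim_compose[OF filterlim_real_sequentially filterlim_Suc]) auto
    then show "(\<lambda>n. ennreal (real (Suc n) powr (1 - s))) \<longlonglongrightarrow> 0"
      using tendsto_ennrealI by fastforce
    obtain N where N: "1 / \<delta> < real N" using reals_Archimedean2 by blast
    show "\<exists>N. \<forall>n\<ge>N. hausdorff_premeasure s \<delta> E \<le> ennreal (real (Suc n) powr (1 - s))"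
    proof (intro exI allI impI)
      fix n assume n: "n \<ge> N"
      define M where "M = Suc n"
      define U where "U i = (if i < M then {real i / M .. (real i + 1) / M} else {})" for i
      have M: "M > 0" by (simp add: M_def)
      have diam: "diameter (U i) = 1 / M" if "i < M" for i
        using that M by (simp add: U_def diameter_closed_interval divide_right_mono field_simps)
      have "1 / M \<le> \<delta>"
      proof -
        have "1 / \<delta> < M" using N n by (simp add: M_def)
        then show ?thesis using \<delta> M by (simp add: field_simps)
      qed
      then have "\<forall>i. bounded (U i) \<and> diameter (U i) \<le> \<delta>"
        using diam \<delta> by (auto simp: U_def)
      moreover have "E \<subseteq> (\<Union>i. U i)"
      proof
        fix x assume "x \<in> E"
        then have x: "0 \<le> x" "x \<le> 1" using E by auto
        show "x \<in> (\<Union>i. U i)"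
        \<comment> \<open>The right endpoint is treated apart:
          \<open>\<lfloor>x * M\<rfloor>\<close> would be \<open>M\<close>, the index of an empty
          set.\<close>
        proof (cases "x = 1")
          case True
          then have "x \<in> U n" by (simp add: U_def M_def)
          then show ?thesis by blast
        next
          case False
          define i where "i = nat \<lfloor>x * M\<rfloor>"
          have i: "real i \<le> x * M" "x * M < real i + 1"
            using x M by (simp_all add: i_def)
          have "x * M < M" using x False M by simp
          then have "i < M" using i by linarith
          then have "x \<in> U i" using i M by (simp add: U_def field_simps)
          then show ?thesis by blast
        qed
      qed
      ultimately have "hausdorff_premeasure s \<delta> E \<le> (\<Sum>i. hausdorff_gauge s (U i))"
        unfolding hausdorff_premeasure_def by (intro INF_lower) auto
      also have "\<dots> = (\<Sum>i<M. hausdorff_gauge s (U i))"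
        by (rule suminf_finite) (auto simp: U_def hausdorff_gauge_def)
      also have "\<dots> \<le> (\<Sum>i<M. ennreal ((1 / M) powr s))"
        using diam s by (intro sum_mono) (auto simp: hausdorff_gauge_def)
      also have "\<dots> = ennreal (M * (1 / M) powr s)"
        by (simp add: ennreal_mult ennreal_of_nat_eq_real_of_nat)
      also have "M * (1 / M) powr s = M powr (1 - s)"
        using M by (simp add: powr_diff powr_divide)
      finally show "hausdorff_premeasure s \<delta> E \<le> ennreal (real (Suc n) powr (1 - s))"
        by (simp add: M_def)
    qed
  qed
  then show ?thesis
    unfolding hausdorff_measure_def by (intro antisym SUP_least) auto
qed

lemma hausdorff_dim_unit_interval_le_1:
  fixes E :: "real set"
  assumes "E \<subseteq> {0..1}"
  shows "hausdorff_dim E \<le> 1"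
proof (rule ennreal_le_epsilon)
  fix e :: real assume "e > 0"
  then have "hausdorff_dim E \<le> ennreal (1 + e)"
    unfolding hausdorff_dim_def
    using hausdorff_measure_unit_interval_eq_0[OF assms, of "1 + e"] by (intro INF_lower) auto
  then show "hausdorff_dim E \<le> 1 + ennreal e"
    using \<open>e > 0\<close> by (simp add: ennreal_plus)
qed

text \<open>Pigeonhole: rounding \<open>(f i - v) / h\<close> down is injective on \<open>S\<close>
  and takes values between 0 and \<open>\<lfloor>D / h\<rfloor>\<close>.\<close>

lemma card_separated_le:
  fixes f :: "'i \<Rightarrow> real"
  assumes h: "h > 0" and D: "D \<ge> 0"
    and range: "\<And>i. i \<in> S \<Longrightarrow> f i \<in> {v..v + D}"
    and sep: "\<And>i j. i \<in> S \<Longrightarrow> j \<in> S \<Longrightarrow> i \<noteq> j \<Longrightarrow> h \<le> \<bar>f i - f j\<bar>"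
  shows "finite S \<and> real (card S) \<le> 1 + D / h"
proof -
  define \<phi> where "\<phi> i = \<lfloor>(f i - v) / h\<rfloor>" for i
  have "inj_on \<phi> S"
  proof (rule inj_onI, rule ccontr)
    fix i j assume ij: "i \<in> S" "j \<in> S" "\<phi> i = \<phi> j" "i \<noteq> j"
    have "\<bar>(f i - v) / h - (f j - v) / h\<bar> < 1"
      using ij(3) unfolding \<phi>_def by linarith
    moreover have "(f i - v) / h - (f j - v) / h = (f i - f j) / h"
      by (simp add: diff_divide_distrib)
    ultimately have "\<bar>f i - f j\<bar> < h" using h by (simp add: abs_divide)
    then show False using sep[OF ij(1,2,4)] by simp
  qed
  moreover have sub: "\<phi> ` S \<subseteq> {0..\<lfloor>D / h\<rfloor>}"
    using range h by (fastforce simp: \<phi>_def intro!: floor_mono divide_right_mono)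
  ultimately have fin: "finite S"
    by (meson finite_atLeastAtMost_int finite_imageD finite_subset)
  have "card S = card (\<phi> ` S)" by (simp add: card_image \<open>inj_on \<phi> S\<close>)
  also have "\<dots> \<le> card {0..\<lfloor>D / h\<rfloor>}" by (rule card_mono[OF _ sub]) simp
  finally have "card S \<le> nat (\<lfloor>D / h\<rfloor> + 1)"
    by simp
  moreover have "0 \<le> \<lfloor>D / h\<rfloor>" using D h by simp
  ultimately have "real (card S) \<le> real_of_int (\<lfloor>D / h\<rfloor> + 1)" by linarith
  also have "\<dots> \<le> 1 + D / h" by simp
  finally show ?thesis using fin by simp
qed


section \<open>Cantor sets with a Hoelder inverse parametrization\<close>

text \<open>
  The left endpoint of the \<open>j\<close>-th interval of level \<open>k\<close> in a construction where every interval has \<open>M\<close>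
  children: \<open>e k u i\<close> is the offset, in multiples of \<open>l (Suc k)\<close>, of the \<open>i\<close>-th child of the level \<open>k\<close> interval
  starting at \<open>u\<close>. Starting from a whole row of intervals of length \<open>l 0\<close>, of which only \<open>j = 0\<close> matters,
  avoids the side condition \<open>j < M ^ k\<close>.
\<close>

primrec cantor_endpoint :: "nat \<Rightarrow> (nat \<Rightarrow> real) \<Rightarrow> (nat \<Rightarrow> real \<Rightarrow> nat \<Rightarrow> nat) \<Rightarrow> nat \<Rightarrow> nat \<Rightarrow> real" where
  "cantor_endpoint M l e 0 j = real j * l 0"
| "cantor_endpoint M l e (Suc k) j =
     cantor_endpoint M l e k (j div M) + real (e k (cantor_endpoint M l e k (j div M)) (j mod M)) * l (Suc k)"

context
  fixes R M :: nat and \<delta> :: real and l :: "nat \<Rightarrow> real" and e :: "nat \<Rightarrow> real \<Rightarrow> nat \<Rightarrow> nat"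
  assumes R: "R \<ge> 2" and M: "M \<ge> 2" and \<delta>: "\<delta> > 0"
    and l: "\<And>k. l k = \<delta> / real R ^ k"
    and e_less: "\<And>k u i. i < M \<Longrightarrow> e k u i < R"
    and e_mono: "\<And>k u i j. i < j \<Longrightarrow> j < M \<Longrightarrow> e k u i < e k u j"
begin

private abbreviation "ep \<equiv> cantor_endpoint M l e"

private lemma l_pos: "l k > 0"
  using R \<delta> by (simp add: l)

private lemma l_Suc: "l k = real R * l (Suc k)"
  using R by (simp add: l)

private lemma ep_child_lower: "ep k (j div M) \<le> ep (Suc k) j"
  using l_pos[of "Suc k"] by simp

private lemma ep_child_upper: "ep (Suc k) j + l (Suc k) \<le> ep k (j div M) + l k"
proof -
  have "real (e k (ep k (j div M)) (j mod M)) + 1 \<le> real R"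
    using e_less[of "j mod M" k "ep k (j div M)"] M
    by (metis Suc_leI add.commute less_le_trans mod_less_divisor of_nat_Suc of_nat_mono pos2)
  then have "(real (e k (ep k (j div M)) (j mod M)) + 1) * l (Suc k) \<le> real R * l (Suc k)"
    using l_pos[of "Suc k"] by (intro mult_right_mono) auto
  then show ?thesis unfolding l_Suc[of k] by (simp add: algebra_simps)
qed

text \<open>Siblings are apart because their offsets increase strictly; children of different
  parents stay inside their parents, which are apart by induction.\<close>

private lemma ep_separated: "i < j \<Longrightarrow> ep k i + l k \<le> ep k j"
proof (induction k arbitrary: i j)
  case 0
  then have "(real i + 1) * l 0 \<le> real j * l 0"
    using l_pos[of 0] by (intro mult_right_mono) auto
  then show ?case by (simp add: algebra_simps)
next
  case (Suc k)
  show ?case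
  proof (cases "i div M = j div M")
    case True
    then have "i mod M < j mod M"
      using Suc.prems by (metis div_mult_mod_eq nat_add_left_cancel_less)
    then have "e k (ep k (i div M)) (i mod M) < e k (ep k (i div M)) (j mod M)"
      using M by (intro e_mono) auto
    then have "(real (e k (ep k (i div M)) (i mod M)) + 1) * l (Suc k)
                \<le> real (e k (ep k (i div M)) (j mod M)) * l (Suc k)"
      using l_pos[of "Suc k"] by (intro mult_right_mono) auto
    then show ?thesis using True by (simp add: algebra_simps)
  next
    case False
    then have "i div M < j div M"
      using Suc.prems by (simp add: div_le_mono le_neq_implies_less)
    then have "ep k (i div M) + l k \<le> ep k (j div M)" by (rule Suc.IH)
    then show ?thesis
      using ep_child_upper[of k i] ep_child_lower[of k j] by linarith
  qed
qed

text \<open>For \<open>t\<close> in \<open>{0..<1}\<close>, the first \<open>k\<close> digits of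
  \<open>t\<close> in base \<open>M\<close>, read as an integer. They select the interval of level
  \<open>k\<close> that contains the image of \<open>t\<close>.\<close>

private definition "cell k t = nat \<lfloor>real M ^ k * t\<rfloor>"

private lemma cell_Suc_div: "cell (Suc k) t div M = cell k t"
proof -
  have "\<lfloor>real M ^ Suc k * t\<rfloor> div int M = \<lfloor>real M ^ k * t\<rfloor>"
    using M floor_divide_real_eq_div[of "int M" "real M ^ Suc k * t"] by simp
  then show ?thesis
    unfolding cell_def by (metis nat_div_distrib' nat_int of_nat_0_le_iff)
qed

text \<open>The left endpoints increase along the nested intervals selected by the digits of
  \<open>t\<close>, so their supremum is the common point of these intervals.\<close>

private definition "cantor_map t = (SUP k. ep k (cell k t))"

private lemma ep_cell_nested:
  "k \<le> k' \<Longrightarrow> ep k (cell k t) \<le> ep k' (cell k' t) \<and>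
     ep k' (cell k' t) + l k' \<le> ep k (cell k t) + l k"
proof (induction k' rule: dec_induct)
  case (step k')
  then show ?case
    using ep_child_lower[of k' "cell (Suc k') t"] ep_child_upper[of k' "cell (Suc k') t"]
    unfolding cell_Suc_div by linarith
qed simp

private lemma cantor_map_mem: "cantor_map t \<in> {ep k (cell k t)..ep k (cell k t) + l k}"
proof -
  have upper: "ep k' (cell k' t) \<le> ep k (cell k t) + l k" for k'
  proof (cases "k \<le> k'")
    case True
    then show ?thesis using ep_cell_nested[of k k' t] l_pos[of k'] by linarith
  next
    case False
    then show ?thesis using ep_cell_nested[of k' k t] l_pos[of k] by auto
  qed
  then have "bdd_above (range (\<lambda>k. ep k (cell k t)))" by (auto intro!: bdd_aboveI2)
  then show ?thesis
    using upper unfolding cantor_map_def by (auto intro!: cSUP_upper cSUP_least)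
qed

text \<open>If the parameters were \<open>2 / M ^ k\<close> apart, their cells would differ by at
  least 2, leaving room for a whole interval of length \<open>l k\<close> between the two
  images.\<close>

private lemma cantor_map_close:
  assumes t: "0 \<le> t" "0 \<le> t'" and close: "\<bar>cantor_map t - cantor_map t'\<bar> < l k"
  shows "\<bar>t - t'\<bar> < 2 / real M ^ k"
  using assms
proof (induction t t' rule: linorder_wlog)
  case (le t t')
  have Mk: "real M ^ k > 0" using M by simp
  show ?case
  proof (rule ccontr)
    assume "\<not> \<bar>t - t'\<bar> < 2 / real M ^ k"
    then have "real M ^ k * t + 2 \<le> real M ^ k * t'"
      using le Mk by (simp add: field_simps)
    then have "\<lfloor>real M ^ k * t\<rfloor> + 2 \<le> \<lfloor>real M ^ k * t'\<rfloor>" by linarith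
    moreover have "0 \<le> \<lfloor>real M ^ k * t\<rfloor>" using le by simp
    ultimately have "cell k t + 2 \<le> cell k t'"
      unfolding cell_def by linarith
    then have "ep k (cell k t) + l k \<le> ep k (Suc (cell k t))"
      "ep k (Suc (cell k t)) + l k \<le> ep k (cell k t')"
      by (auto intro: ep_separated)
    then show False
      using cantor_map_mem[of t k] cantor_map_mem[of t' k] le by auto
  qed
next
  case (sym t t')
  then show ?case by (simp add: abs_minus_commute)
qed

text \<open>The distance \<open>d\<close> of the images is compared with the first level satisfying
  \<open>l k \<le> d\<close>. The condition on \<open>\<sigma>\<close> gives
  \<open>1 / M ^ k \<le> (l k / \<delta>) powr \<sigma>\<close>.\<close>

private lemma cantor_map_Hoelder:
  assumes t: "t \<in> {0..<1}" "t' \<in> {0..<1}" and \<sigma>: "\<sigma> > 0" "real R powr \<sigma> \<le> real M"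
  shows "\<bar>t - t'\<bar> \<le> 2 * M / \<delta> powr \<sigma> * \<bar>cantor_map t - cantor_map t'\<bar> powr \<sigma>"
proof -
  define d where "d = \<bar>cantor_map t - cantor_map t'\<bar>"
  consider "d = 0" | "0 < d" "d < \<delta>" | "\<delta> \<le> d" by (fastforce simp: d_def)
  then show ?thesis
  proof cases
    case 1
    \<comment> \<open>The right-hand side of the goal is 0 here, so \<open>t = t'\<close> is needed;
      it follows by using all levels at once.\<close>
    have "\<bar>t - t'\<bar> \<le> 2 / real M ^ k" for k
      using cantor_map_close[of t t' k] 1 l_pos[of k] t by (auto simp: d_def)
    moreover have "(\<lambda>k. 2 / real M ^ k) \<longlonglongrightarrow> 0"
      using M by (intro LIMSEQ_divide_realpow_zero) auto
    ultimately have "\<bar>t - t'\<bar> \<le> 0" by (intro LIMSEQ_le_const) auto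
    then show ?thesis by simp
  next
    case 2
    have "(\<lambda>k. \<delta> / real R ^ k) \<longlonglongrightarrow> 0"
      using R by (intro LIMSEQ_divide_realpow_zero) auto
    then have "eventually (\<lambda>k. \<delta> / real R ^ k < d) sequentially"
      using 2 by (intro order_tendstoD)
    then have "\<exists>k. l k \<le> d"
      by (auto simp: l eventually_sequentially intro: less_imp_le)
    then obtain k where k: "l k \<le> d" "\<And>i. i < k \<Longrightarrow> \<not> l i \<le> d"
      using exists_least_iff[of "\<lambda>k. l k \<le> d"] by auto
    \<comment> \<open>Level 0 has length \<open>\<delta> > d\<close>, so there is a preceding level,
      whose length exceeds \<open>d\<close>.\<close>
    have "k \<noteq> 0" using k 2 by (intro notI) (simp add: l)
    then obtain k' where k': "k = Suc k'" by (cases k) auto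
    have "d < l k'" using k(2)[of k'] k' by simp
    then have "\<bar>t - t'\<bar> \<le> 2 / real M ^ k'"
      using cantor_map_close[of t t' k'] t by (auto simp: d_def)
    \<comment> \<open>Returning from level \<open>k'\<close> to level \<open>k\<close> costs the
      factor \<open>M\<close> of the Hoelder constant.\<close>
    also have "\<dots> = 2 * M / real M ^ k" using M k' by simp
    also have "\<dots> \<le> 2 * M / (real R powr \<sigma>) ^ k"
      using \<sigma> R M by (intro divide_left_mono power_mono mult_pos_pos) auto
    also have "(real R powr \<sigma>) ^ k = (real R ^ k) powr \<sigma>"
      using R by (simp add: powr_powr mult.commute flip: powr_realpow)
    also have "2 * M / (real R ^ k) powr \<sigma> = 2 * M / \<delta> powr \<sigma> * l k powr \<sigma>"
      using \<delta> R by (simp add: l powr_divide)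
    also have "\<dots> \<le> 2 * M / \<delta> powr \<sigma> * d powr \<sigma>"
      using k \<sigma> l_pos[of k] by (intro mult_left_mono powr_mono2) auto
    finally show ?thesis by (simp add: d_def)
  next
    case 3
    have "\<bar>t - t'\<bar> \<le> 1" using t by auto
    also have "1 \<le> (d / \<delta>) powr \<sigma>" using 3 \<delta> \<sigma> by (intro ge_one_powr_ge_zero) auto
    also have "\<dots> = 1 * (d powr \<sigma> / \<delta> powr \<sigma>)" using 3 \<delta> by (simp add: powr_divide)
    also have "\<dots> \<le> 2 * M * (d powr \<sigma> / \<delta> powr \<sigma>)" using M by (intro mult_right_mono) auto
    finally show ?thesis by (simp add: d_def)
  qed
qed

text \<open>For each \<open>k\<close>, an image point lies in a chosen child of level
  \<open>Suc k\<close>, where \<open>Q k\<close> holds. As \<open>t < 1\<close>, its interval of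
  level 0 has index 0 and is \<open>{0..\<delta>}\<close>.\<close>

lemma cantor_set_hausdorff_dim_ge:
  assumes \<sigma>: "\<sigma> > 0" "real R powr \<sigma> \<le> real M"
    and Q: "\<And>k u i x. i < M \<Longrightarrow> x \<in> {u + e k u i * l (Suc k)..u + (e k u i + 1) * l (Suc k)} \<Longrightarrow> Q k x"
  shows "ennreal \<sigma> \<le> hausdorff_dim {x \<in> {0..\<delta>}. \<forall>k. Q k x}"
proof (rule hausdorff_dim_ge_of_Hoelder_inverse[where g = cantor_map])
  fix t :: real assume t: "t \<in> {0..<1}"
  then have "cantor_map t \<in> {0..\<delta>}"
    using cantor_map_mem[of t 0] by (auto simp: cell_def l floor_eq_iff)
  moreover have "Q k (cantor_map t)" for k
    using cantor_map_mem[of t "Suc k"] M cell_Suc_div[of k t]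
    by (intro Q[of "cell (Suc k) t mod M" _ "ep k (cell k t)"]) (auto simp: algebra_simps)
  ultimately show "cantor_map t \<in> {x \<in> {0..\<delta>}. \<forall>k. Q k x}" by simp
next
  fix t t' :: real assume "t \<in> {0..<1}" "t' \<in> {0..<1}"
  from cantor_map_Hoelder[OF this \<sigma>]
  show "\<bar>t - t'\<bar> \<le> 2 * M / \<delta> powr \<sigma> * dist (cantor_map t) (cantor_map t') powr \<sigma>"
    by (simp add: dist_real_def)
qed (use M \<delta> \<sigma> in auto)

end

lemma hausdorff_dim_mono:
  assumes "E \<subseteq> F"
  shows "hausdorff_dim E \<le> hausdorff_dim F"
proof -
  have pre: "hausdorff_premeasure s \<delta> E \<le> hausdorff_premeasure s \<delta> F" for s \<delta>
    unfolding hausdorff_premeasure_def using assms by (intro INF_superset_mono) auto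
  have "hausdorff_measure s E \<le> hausdorff_measure s F" for s
    unfolding hausdorff_measure_def by (intro SUP_mono') (rule pre)
  then show ?thesis
    unfolding hausdorff_dim_def by (intro INF_superset_mono) (auto, metis le_zero_eq)
qed

section \<open>Counting the fractions near an interval, for badly approximable \<beta>\<close>

lemma ex_dyadic_block:
  fixes N n :: nat
  assumes "N \<le> n" "n < 2 ^ m * N"
  shows "\<exists>j<m. 2 ^ j * N \<le> n \<and> n < 2 * (2 ^ j * N)"
  using assms(2)
proof (induction m)
  case 0
  then show ?case using assms(1) by simp
next
  case (Suc m)
  show ?case
  proof (cases "n < 2 ^ m * N")
    case True
    then show ?thesis using Suc.IH by (meson less_Suc_eq)
  next
    case False
    then show ?thesis using Suc.prems by (intro exI[of _ m]) auto
  qed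
qed

context
  fixes \<beta> c :: real and P :: "nat set" and q :: "nat \<Rightarrow> nat" and y :: "nat \<Rightarrow> real"
  assumes c: "c > 0"
    and badly: "\<And>(a::int) (b::int). b \<ge> 1 \<Longrightarrow> \<bar>\<beta> - of_int a / of_int b\<bar> > c / (of_int b)^2"
    and q_inj: "inj_on q P" and q_pos: "\<And>p. p \<in> P \<Longrightarrow> 1 \<le> q p" and q_le: "\<And>p. p \<in> P \<Longrightarrow> q p \<le> p"
    and y: "\<And>p. y p = of_int (\<lfloor>\<beta> * real p * real (q p)\<rfloor> mod int p) / real p"
begin

text \<open>Multiplying the defining inequality by \<open>b\<close> leaves \<open>c / b\<close>,
  which is at least \<open>c / A\<close>. Negative \<open>b\<close> is included because
  \<open>b\<close> will be a difference of two values of \<open>q\<close>.\<close>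

private lemma badly_approximable_mult:
  assumes "b \<noteq> 0" "\<bar>b\<bar> < A"
  shows "c / A \<le> \<bar>\<beta> * of_int b - of_int k\<bar>"
proof -
  have *: "c / A \<le> \<bar>\<beta> * of_int b - of_int k\<bar>" if b: "b \<ge> 1" "b < A" for b k :: int
  proof -
    have "\<beta> * of_int b - of_int k = (\<beta> - of_int k / of_int b) * of_int b"
      using b by (simp add: field_simps)
    then have "\<bar>\<beta> * of_int b - of_int k\<bar> = \<bar>\<beta> - of_int k / of_int b\<bar> * of_int b"
      using b by (simp add: abs_mult)
    also have "\<dots> \<ge> c / (of_int b)^2 * of_int b"
      using badly[of b k] b by (intro mult_right_mono) auto
    finally have "c / of_int b \<le> \<bar>\<beta> * of_int b - of_int k\<bar>"
      using b by (simp add: power2_eq_square)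
    moreover have "c / A \<le> c / of_int b" using b c by (intro divide_left_mono) auto
    ultimately show ?thesis by simp
  qed
  show ?thesis
  proof (cases "b > 0")
    case True
    then show ?thesis using * assms by simp
  next
    case False
    then have "c / A \<le> \<bar>\<beta> * of_int (- b) - of_int (- k)\<bar>"
      using assms by (intro *) auto
    then show ?thesis by (simp add: abs_minus_commute)
  qed
qed

private lemma card_block_le:
  fixes A :: nat and v L :: real
  assumes A: "A \<ge> 1" and L: "L \<ge> 0"
  defines "S \<equiv> {p \<in> P. A \<le> q p \<and> q p < 2 * A \<and> y p \<in> {v..v + L}}"
  shows "finite S \<and> real (card S) \<le> 1 + (L * A + 1) / c"
proof -
  define X where "X p = \<beta> * real p * real (q p)" for p
  \<comment> \<open>Restoring the fractional part lost in the floor turns \<open>y p\<close> into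
    \<open>\<beta> * q p\<close> modulo 1 exactly, so that bad approximability separates the
    values.\<close>
  define f where "f p = y p + frac (X p) / real p" for p
  have f: "f p = \<beta> * real (q p) - of_int (\<lfloor>X p\<rfloor> div int p)" if "p > 0" for p
  proof -
    have "real_of_int \<lfloor>X p\<rfloor> = real p * of_int (\<lfloor>X p\<rfloor> div int p) + of_int (\<lfloor>X p\<rfloor> mod int p)"
      by (metis mult_div_mod_eq of_int_add of_int_mult of_int_of_nat_eq)
    then have "of_int (\<lfloor>X p\<rfloor> mod int p) + frac (X p) = X p - real p * of_int (\<lfloor>X p\<rfloor> div int p)"
      by (simp add: frac_def)
    then have "(of_int (\<lfloor>X p\<rfloor> mod int p) + frac (X p)) / p = X p / p - of_int (\<lfloor>X p\<rfloor> div int p)"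
      using that by (simp add: diff_divide_distrib)
    moreover have "f p = (of_int (\<lfloor>X p\<rfloor> mod int p) + frac (X p)) / p"
      by (simp add: f_def y X_def add_divide_distrib)
    moreover have "X p / p = \<beta> * real (q p)" using that by (simp add: X_def)
    ultimately show ?thesis by simp
  qed
  have "finite S \<and> real (card S) \<le> 1 + (L + 1 / A) / (c / A)"
  proof (rule card_separated_le[of _ _ S f v])
    fix p assume p: "p \<in> S"
    \<comment> \<open>This is where \<open>q p \<le> p\<close> enters: the shift from
      \<open>y p\<close> to \<open>f p\<close> is at most \<open>1 / A\<close>, which lengthens the
      window by as much.\<close>
    then have "A \<le> p" using q_le by (force simp: S_def)
    then have "frac (X p) / p \<le> 1 / A"
      using A frac_lt_1[of "X p"] by (intro frac_le) auto
    moreover have "0 \<le> frac (X p) / p" by (simp add: frac_ge_0)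
    ultimately show "f p \<in> {v..v + (L + 1 / A)}"
      using p unfolding S_def f_def atLeastAtMost_iff mem_Collect_eq by linarith
  next
    fix p p' assume p: "p \<in> S" "p' \<in> S" "p \<noteq> p'"
    then have "q p \<noteq> q p'" using q_inj by (auto simp: S_def inj_on_def)
    then have "c / A \<le> \<bar>\<beta> * of_int (int (q p) - int (q p')) -
        of_int (\<lfloor>X p\<rfloor> div int p - \<lfloor>X p'\<rfloor> div int p')\<bar>"
      using p by (intro badly_approximable_mult) (auto simp: S_def)
    moreover have "p > 0" "p' > 0" using p A q_le by (force simp: S_def)+
    ultimately show "c / A \<le> \<bar>f p - f p'\<bar>"
      by (simp add: f algebra_simps)
  qed (use A L c in auto)
  moreover have "(L + 1 / A) / (c / A) = (L * A + 1) / c"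
    using A c by (simp add: field_simps)
  ultimately show ?thesis by metis
qed

text \<open>Each \<open>p\<close> with \<open>y p\<close> near the parent interval spoils at most 4
  offsets. Summing the number of such \<open>p\<close> over the \<open>m\<close> dyadic blocks gives
  a term linear in \<open>m\<close> and a term of order \<open>\<delta> / c * 2 ^ m\<close>; each is
  at most a quarter of \<open>2 ^ m\<close>.\<close>

private lemma many_good_offsets:
  fixes N m :: nat and \<delta> u :: real
  assumes N: "N \<ge> 1" and m: "m \<ge> 1" and \<delta>: "\<delta> > 0" "\<delta> \<le> c / 32"
    and m_large: "4 * real m * (1 + 1 / c) \<le> 2 ^ m / 4"
  defines "h \<equiv> \<delta> / (2 ^ m * real N)"
  shows "2 ^ (m - 1) \<le> card {e. e < 2 ^ m \<and> (\<forall>p\<in>P. N \<le> q p \<longrightarrow> q p < 2 ^ m * N \<longrightarrow>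
           (\<forall>x\<in>{u + real e * h..u + real (e + 1) * h}. \<delta> / 2 ^ m / p \<le> \<bar>x - y p\<bar>))}"
    (is "_ \<le> card ?G")
proof -
  have h: "h > 0" using \<delta> N by (simp add: h_def)
  \<comment> \<open>The window contains the parent interval, of length
    \<open>\<delta> / N = 2 ^ m * h\<close>, together with a margin \<open>h\<close> on both
    sides.\<close>
  define S where "S j = {p \<in> P. 2 ^ j * N \<le> q p \<and> q p < 2 * (2 ^ j * N) \<and>
      y p \<in> {u - h..u - h + 2 * \<delta> / N}}" for j :: nat
  \<comment> \<open>If the \<open>e\<close>-th child comes within \<open>h\<close> of
    \<open>y p\<close>, then \<open>(y p - u) / h\<close> lies between \<open>e - 1\<close> and
    \<open>e + 2\<close>; this confines \<open>e\<close> to a window of length 3.\<close>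
  define B where "B p = {e :: nat. real e \<in> {(y p - u) / h - 2..(y p - u) / h - 2 + 3}}" for p
  have S: "finite (S j)" "real (card (S j)) \<le> 1 + 1 / c + 2 * \<delta> / c * 2 ^ j" for j
  proof -
    have "1 + (2 * \<delta> / N * real (2 ^ j * N) + 1) / c = 1 + 1 / c + 2 * \<delta> / c * 2 ^ j"
      using N by (simp add: add_divide_distrib)
    then show "finite (S j)" "real (card (S j)) \<le> 1 + 1 / c + 2 * \<delta> / c * 2 ^ j"
      using card_block_le[of "2 ^ j * N" "2 * \<delta> / N" "u - h"] N \<delta> unfolding S_def by auto
  qed
  have B: "finite (B p)" "card (B p) \<le> 4" for p
    using card_separated_le[of 1 3 "B p" real "(y p - u) / h - 2"]
    by (auto simp: B_def)
  have "{..<2 ^ m} - ?G \<subseteq> (\<Union>j<m. \<Union>p\<in>S j. B p)"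
  proof
    fix e :: nat assume "e \<in> {..<2 ^ m} - ?G"
    then obtain p x where e: "e < 2 ^ m" and p: "p \<in> P" "N \<le> q p" "q p < 2 ^ m * N"
      and x: "x \<in> {u + real e * h..u + real (e + 1) * h}" "\<bar>x - y p\<bar> < \<delta> / 2 ^ m / p"
      by (auto simp: not_le)
    obtain j where j: "j < m" "2 ^ j * N \<le> q p" "q p < 2 * (2 ^ j * N)"
      using ex_dyadic_block[OF p(2,3)] by blast
    have "N \<le> p" using p q_le order_trans by blast
    then have "\<delta> / 2 ^ m / p \<le> h"
      using N \<delta> unfolding h_def divide_divide_eq_left by (intro divide_left_mono mult_left_mono) auto
    then have close: "\<bar>x - y p\<bar> < h" using x by simp
    have up: "y p \<le> u + real e * h + 2 * h" and low: "u + real e * h - h \<le> y p"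
      using close x by (auto simp: algebra_simps)
    have "(real e + 3) * h \<le> (2 * 2 ^ m) * h"
    proof (intro mult_right_mono)
      have "(2::nat) ^ 1 \<le> 2 ^ m" using m by (intro power_increasing) auto
      then have "e + 3 \<le> 2 * 2 ^ m" using e by simp
      then show "real e + 3 \<le> 2 * 2 ^ m"
        by (metis (mono_tags) of_nat_add of_nat_le_iff of_nat_mult of_nat_numeral of_nat_power)
    qed (use h in auto)
    also have "\<dots> = 2 * \<delta> / N" using N by (simp add: h_def)
    finally have "y p \<le> u - h + 2 * \<delta> / N" using up by (simp add: algebra_simps)
    moreover have "0 \<le> real e * h" using h by simp
    then have "u - h \<le> y p" using low by linarith
    ultimately have "p \<in> S j" using p j by (simp add: S_def)
    moreover have "e \<in> B p"
      using up low h by (auto simp: B_def field_simps)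
    ultimately show "e \<in> (\<Union>j<m. \<Union>p\<in>S j. B p)" using j by blast
  qed
  then have "card ({..<2 ^ m} - ?G) \<le> card (\<Union>j<m. \<Union>p\<in>S j. B p)"
    using S B by (intro card_mono) auto
  also have "\<dots> \<le> (\<Sum>j<m. card (\<Union>p\<in>S j. B p))" by (rule card_UN_le) simp
  also have "\<dots> \<le> (\<Sum>j<m. \<Sum>p\<in>S j. card (B p))" using S by (intro sum_mono card_UN_le)
  also have "\<dots> \<le> (\<Sum>j<m. \<Sum>p\<in>S j. 4)" using B by (intro sum_mono)
  finally have "real (card ({..<2 ^ m} - ?G)) \<le> real (\<Sum>j<m. \<Sum>p\<in>S j. 4)"
    by (rule of_nat_mono)
  also have "\<dots> = (\<Sum>j<m. real (card (S j)) * 4)" by simp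
  also have "\<dots> \<le> (\<Sum>j<m. (1 + 1 / c + 2 * \<delta> / c * 2 ^ j) * 4)"
    using S by (intro sum_mono mult_right_mono) auto
  also have "\<dots> = 4 * real m * (1 + 1 / c) + 8 * \<delta> / c * (\<Sum>j<m. 2 ^ j)"
    by (simp add: sum.distrib sum_distrib_left sum_distrib_right sum_divide_distrib algebra_simps)
  also have "(\<Sum>j<m. 2 ^ j) = (2 ^ m - 1 :: real)"
    by (simp add: geometric_sum)
  \<comment> \<open>The bound \<open>\<delta> \<le> c / 32\<close> is chosen to make this factor at
    most \<open>1 / 4\<close>.\<close>
  also have "8 * \<delta> / c * (2 ^ m - 1) \<le> 1 / 4 * (2 ^ m :: real)"
    using \<delta> c by (intro mult_mono) (auto simp: field_simps)
  also have "4 * real m * (1 + 1 / c) + 1 / 4 * 2 ^ m \<le> 2 ^ m / 2" using m_large by simp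
  also have "(2::real) ^ m / 2 = real (2 ^ (m - 1))"
    using m by (cases m) auto
  finally have "card ({..<2 ^ m} - ?G) \<le> 2 ^ (m - 1)" by simp
  moreover have "card ({..<2 ^ m} - ?G) = 2 ^ m - card ?G"
    by (subst card_Diff_subset) auto
  moreover have "(2::nat) ^ m = 2 ^ (m - 1) + 2 ^ (m - 1)"
    using m by (cases m) auto
  ultimately show ?thesis by linarith
qed

text \<open>The Cantor construction with \<open>R = 2 ^ m\<close> pieces, of which
  \<open>M = 2 ^ (m - 1)\<close> are kept, has exponent \<open>1 - 1 / m\<close> since
  \<open>R powr (1 - 1 / m) = M\<close>. Level \<open>k\<close> handles the \<open>p\<close> with
  \<open>R ^ k \<le> q p < R ^ (k + 1)\<close>, and these ranges exhaust \<open>P\<close>.\<close>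

private lemma avoiding_set_hausdorff_dim_ge:
  fixes m :: nat and \<delta> :: real
  assumes m: "m \<ge> 2" and \<delta>: "\<delta> > 0" "\<delta> \<le> c / 32"
    and m_large: "4 * real m * (1 + 1 / c) \<le> 2 ^ m / 4"
  shows "ennreal (1 - 1 / m) \<le> hausdorff_dim {x \<in> {0..\<delta>}. \<forall>p\<in>P. \<delta> / 2 ^ m / p \<le> \<bar>x - y p\<bar>}"
proof -
  define R M :: nat where "R = 2 ^ m" and "M = 2 ^ (m - 1)"
  define l where "l k = \<delta> / real R ^ k" for k :: nat
  define Q where "Q k x \<longleftrightarrow> (\<forall>p\<in>P. R ^ k \<le> q p \<longrightarrow> q p < R * R ^ k \<longrightarrow> \<delta> / 2 ^ m / p \<le> \<bar>x - y p\<bar>)"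
    for k x
  define G where "G k u = {e. e < R \<and> (\<forall>x\<in>{u + real e * l (Suc k)..u + real (e + 1) * l (Suc k)}. Q k x)}"
    for k u
  \<comment> \<open>The good offsets are listed in increasing order; only the first \<open>M\<close>
    are used.\<close>
  define e where "e k u i = sorted_list_of_set (G k u) ! i" for k u i
  have R: "R \<ge> 2" and M: "M \<ge> 2"
    using m power_increasing[of 1 m "2::nat"] power_increasing[of 1 "m - 1" "2::nat"]
    by (auto simp: R_def M_def)
  have fin: "finite (G k u)" for k u by (simp add: G_def)
  have card: "M \<le> card (G k u)" for k u
  proof -
    have "M \<le> card {e. e < 2 ^ m \<and> (\<forall>p\<in>P. R ^ k \<le> q p \<longrightarrow> q p < 2 ^ m * R ^ k \<longrightarrow>
       (\<forall>x\<in>{u + real e * (\<delta> / (2 ^ m * real (R ^ k)))..u + real (e + 1) * (\<delta> / (2 ^ m * real (R ^ k)))}.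
          \<delta> / 2 ^ m / p \<le> \<bar>x - y p\<bar>))}"
      unfolding M_def using m \<delta> m_large R by (intro many_good_offsets) auto
    also have "\<delta> / (2 ^ m * real (R ^ k)) = l (Suc k)" by (simp add: l_def R_def)
    finally show ?thesis
      by (rule order_trans) (auto intro!: card_mono simp: G_def Q_def R_def)
  qed
  have mem: "e k u i \<in> G k u" if "i < M" for k u i
    using that card[of k u] fin nth_mem[of i "sorted_list_of_set (G k u)"] by (simp add: e_def)
  have "ennreal (1 - 1 / m) \<le> hausdorff_dim {x \<in> {0..\<delta>}. \<forall>k. Q k x}"
  proof (rule cantor_set_hausdorff_dim_ge[of R M \<delta> l e])
    show "e k u i < e k u j" if "i < j" "j < M" for k u i j
      using that card[of k u] fin unfolding e_def
      by (intro sorted_wrt_nth_less[OF strict_sorted_list_of_set]) auto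
    have "real R powr (1 - 1 / m) = 2 powr (m * (1 - 1 / m))"
      unfolding R_def by (simp add: powr_powr flip: powr_realpow)
    also have "real m * (1 - 1 / m) = real (m - 1)" using m by (simp add: field_simps of_nat_diff)
    finally show "real R powr (1 - 1 / m) \<le> real M" by (simp add: powr_realpow M_def)
    show "Q k x" if "i < M" "x \<in> {u + e k u i * l (Suc k)..u + (e k u i + 1) * l (Suc k)}" for k u i x
      using mem[OF that(1), of k u] that(2) by (auto simp: G_def)
  qed (use R M \<delta> m mem in \<open>auto simp: l_def G_def\<close>)
  also have "\<dots> \<le> hausdorff_dim {x \<in> {0..\<delta>}. \<forall>p\<in>P. \<delta> / 2 ^ m / p \<le> \<bar>x - y p\<bar>}"
  proof (rule hausdorff_dim_mono, clarify)
    fix x p assume Qx: "\<forall>k. Q k x" and p: "p \<in> P"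
    obtain k where "R ^ k \<le> q p" "q p < R ^ (k + 1)"
      using ex_power_ivl1[OF R q_pos[OF p]] by auto
    then show "\<delta> / 2 ^ m / p \<le> \<bar>x - y p\<bar>" using Qx p by (simp add: Q_def)
  qed
  finally show ?thesis .
qed

text \<open>Here \<open>m\<close> tends to infinity with \<open>\<delta>\<close> fixed. The
  avoidance constant \<open>\<delta> / 2 ^ m\<close> shrinks with \<open>m\<close>, so \<epsilon> is
  quantified inside the set.\<close>

lemma uniformly_avoiding_set_hausdorff_dim:
  "hausdorff_dim {x \<in> {0..1}. \<exists>\<epsilon>>0. \<forall>p\<in>P. \<epsilon> / p \<le> \<bar>x - y p\<bar>} = 1" (is "hausdorff_dim ?E = 1")
proof (rule antisym)
  show "hausdorff_dim ?E \<le> 1" by (rule hausdorff_dim_unit_interval_le_1) auto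
  define \<delta> where "\<delta> = min 1 (c / 32)"
  have \<delta>: "\<delta> > 0" "\<delta> \<le> c / 32" "\<delta> \<le> 1" using c by (auto simp: \<delta>_def)
  \<comment> \<open>This is the largeness condition on \<open>m\<close> with denominators
    cleared.\<close>
  have "(\<lambda>m. 16 * (1 + 1 / c) * (real m * (1 / 2) ^ m)) \<longlonglongrightarrow> 16 * (1 + 1 / c) * 0"
    by (intro tendsto_mult powser_times_n_limit_0 tendsto_const) auto
  then have "eventually (\<lambda>m. 16 * (1 + 1 / c) * (real m * (1 / 2) ^ m) < 1) sequentially"
    by (rule order_tendstoD) simp
  moreover have "eventually (\<lambda>m. m \<ge> (2::nat)) sequentially" by (rule eventually_ge_at_top)
  ultimately have ev: "eventually (\<lambda>m. ennreal (1 - 1 / real m) \<le> hausdorff_dim ?E) sequentially"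
  proof eventually_elim
    case (elim m)
    then have "4 * real m * (1 + 1 / c) \<le> 2 ^ m / 4" by (simp add: field_simps)
    then have "ennreal (1 - 1 / m) \<le> hausdorff_dim {x \<in> {0..\<delta>}. \<forall>p\<in>P. \<delta> / 2 ^ m / p \<le> \<bar>x - y p\<bar>}"
      using elim \<delta> by (intro avoiding_set_hausdorff_dim_ge) auto
    also have "\<dots> \<le> hausdorff_dim ?E"
      using \<delta> by (intro hausdorff_dim_mono) (auto intro!: exI[of _ "\<delta> / 2 ^ m"])
    finally show ?case .
  qed
  have "(\<lambda>m. ennreal (1 - 1 / real m)) \<longlonglongrightarrow> ennreal (1 - 0)"
    by (intro tendsto_ennrealI tendsto_diff lim_1_over_n tendsto_const)
  then show "1 \<le> hausdorff_dim ?E"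
    using tendsto_upperbound[OF _ ev] by simp
qed

end

section \<open>Application to the sequences indexed by primes\<close>

text \<open>Uniform avoidance with constant \<epsilon> keeps the limit inferior at least \<epsilon>,
  so the set of full dimension found above lies in the complement.\<close>

lemma hausdorff_dim_complement_prime_approx_set:
  fixes q :: "nat \<Rightarrow> nat"
  assumes "badly_approximable \<beta>"
    and q: "inj_on q {p. prime p}" "\<And>p. prime p \<Longrightarrow> 1 \<le> q p" "\<And>p. prime p \<Longrightarrow> q p \<le> p"
  shows "hausdorff_dim ({0..1} - prime_approx_set (\<lambda>p. \<lfloor>\<beta> * real p * real (q p)\<rfloor> mod int p)) = 1"
    (is "hausdorff_dim ({0..1} - prime_approx_set ?a) = 1")
proof (rule antisym)
  show "hausdorff_dim ({0..1} - prime_approx_set ?a) \<le> 1"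
    by (rule hausdorff_dim_unit_interval_le_1) auto
  obtain c where c: "c > 0"
    "\<And>(a::int) (b::int). b \<ge> 1 \<Longrightarrow> \<bar>\<beta> - of_int a / of_int b\<bar> > c / (of_int b)^2"
    using assms(1) by (auto simp: badly_approximable_def)
  define y where "y p = of_int (?a p) / real p" for p
  have "1 = hausdorff_dim {x \<in> {0..1}. \<exists>\<epsilon>>0. \<forall>p\<in>{p. prime p}. \<epsilon> / real p \<le> \<bar>x - y p\<bar>}"
    using uniformly_avoiding_set_hausdorff_dim[OF c q(1), of y] q(2,3) by (auto simp: y_def)
  also have "\<dots> \<le> hausdorff_dim ({0..1} - prime_approx_set ?a)"
  proof (intro hausdorff_dim_mono subsetI)
    fix x
    assume "x \<in> {x \<in> {0..1}. \<exists>\<epsilon>>0. \<forall>p\<in>{p. prime p}. \<epsilon> / real p \<le> \<bar>x - y p\<bar>}"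
    then obtain \<epsilon> where \<epsilon>: "\<epsilon> > 0" and avoid: "\<forall>p\<in>{p. prime p}. \<epsilon> / real p \<le> \<bar>x - y p\<bar>"
      and x: "x \<in> {0..1}"
      by auto
    have "eventually (\<lambda>p. ereal \<epsilon> \<le> ereal (real p * \<bar>x - y p\<bar>)) primes_at_top"
      using avoid unfolding primes_at_top_def eventually_inf_principal
      by (intro always_eventually) (auto simp: pos_divide_le_eq prime_gt_0_nat mult.commute)
    then have "ereal \<epsilon> \<le> Liminf primes_at_top (\<lambda>p. ereal (real p * \<bar>x - y p\<bar>))"
      by (rule Liminf_bounded)
    then show "x \<in> {0..1} - prime_approx_set ?a"
      using \<epsilon> x by (auto simp: prime_approx_set_def y_def)
  qed
  finally show "1 \<le> hausdorff_dim ({0..1} - prime_approx_set ?a)" .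
qed

lemma prime_index_le:
  assumes "prime p"
  shows "prime_index p \<le> p"
proof -
  have "prime_index p - 1 \<le> enumerate {q::nat. prime q} (prime_index p - 1)"
    by (rule le_enumerate[OF primes_infinite])
  then have "prime_index p - 1 \<le> p" using enumerate_prime_index[OF assms] by simp
  \<comment> \<open>The general bound for enumerations is one short. Strictness comes from the first
    prime being nonzero and each step adding at least 1.\<close>
  moreover have "prime_index p - 1 \<noteq> p"
  proof
    assume "prime_index p - 1 = p"
    then have "enumerate {q::nat. prime q} p = p"
      using enumerate_prime_index[OF assms] by simp
    moreover have "enumerate {q::nat. prime q} 0 + p \<le> enumerate {q::nat. prime q} p"
      by (induction p) (use enumerate_step[OF primes_infinite] in \<open>auto simp: less_eq_Suc_le intro: order_trans\<close>)
    moreover have "enumerate {q::nat. prime q} 0 \<noteq> 0"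
      using enumerate_in_set[OF primes_infinite, of 0] by (metis mem_Collect_eq not_prime_0)
    ultimately show False by simp
  qed
  ultimately show ?thesis by simp
qed

theorem theorem1p9:
  fixes \<beta> :: real
  assumes "\<beta> > 0" and "badly_approximable \<beta>"
  shows "hausdorff_dim ({0..1} - prime_approx_set (seq_a \<beta>)) = 1 \<and>
         hausdorff_dim ({0..1} - prime_approx_set (seq_b \<beta>)) = 1"
proof
  have "inj_on prime_index {p. prime p}"
    by (rule inj_onI) (metis enumerate_prime_index(2) mem_Collect_eq)
  from hausdorff_dim_complement_prime_approx_set[OF assms(2) this]
  show "hausdorff_dim ({0..1} - prime_approx_set (seq_a \<beta>)) = 1"
    using enumerate_prime_index(1) prime_index_le by (simp add: seq_a_def[abs_def])
  have "inj_on (\<lambda>p. p) {p::nat. prime p}" by simp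
  from hausdorff_dim_complement_prime_approx_set[OF assms(2) this]
  show "hausdorff_dim ({0..1} - prime_approx_set (seq_b \<beta>)) = 1"
    using prime_ge_1_nat by (simp add: seq_b_def[abs_def] power2_eq_square mult.assoc)
qed

end
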